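(* Let $N\ge 3$, $r>1$, let $\mathbf f\in C^{r+1}(U\times V,\mathbb R^N)$ with $U\subset\mathbb R^N$, $V\subset\mathbb R$ open and connected, and suppose that for every $\mu\in V$ the system $\dot{\mathbf x}=\mathbf f(\mathbf x;\mu)$ has a fixed point $\mathbf x_0(\mu)\in U$ depending $C^r$-smoothly on $\mu$. Let $\mathbf A(\mu)=D_{\mathbf x}\mathbf f(\mathbf x_0(\mu),\mu)$ have eigenvalues $\lambda_1(\mu),\dots,\lambda_N(\mu)$ and let $\mu_0\in V$. Assume: (A4) $\lambda_{1,2}(\mu)=\alpha(\mu)\pm i\omega(\mu)$ with $\omega(\mu)\ne 0$, $\alpha(\mu_0)=0$, $\alpha(\mu)<0$ for all $\mu<\mu_0$ and $\alpha(\mu)>0$ for all $\mu>\mu_0$; and $\operatorname{Re}\lambda_N(\mu)\le\dots\le\operatorname{Re}\lambda_3(\mu)<0$ for all $\mu\in V$. (A5) $\lambda_3(\mu)=\nu(\mu)$ is real and negative, with $\nu(\mu)<\operatorname{Re}\lambda_{1,2}(\mu)$, for all $\mu\le\mu_0$. (A6) For all $\mu$ the eigenvalues $\lambda_1(\mu),\lambda_2(\mu),\lambda_3(\mu)$ are simple and disjoint from the rest of the spectrum of $\mathbf A(\mu)$. Write $$\alpha(\mu)=a(\mu_0-\mu)^p+o(|\mu_0-\mu|^p),\qquad \nu(\mu)=\nu_0+b(\mu_0-\mu)+o(|\mu_0-\mu|)$$ for $\mu<\mu_0$, with constants $a<0$, $\nu_0<0$, $b\in\mathbb R$ and an integer $1\le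 p\le r$. Then there exists a sequence of parameters $\{\mu_{2m},\ m\in\mathbb N\}$ with $\mu_{2m}<\mu_0$ and $\mu_{2m}\to\mu_0$ as $m\to\infty$ such that the nonresonance condition $$\nu(\mu)\neq 2m\,\alpha(\mu),\qquad 2\le 2m\le\left\lfloor\frac{\nu(\mu)}{\alpha(\mu)}\right\rfloor+1,$$ fails at $\mu=\mu_{2m}$, i.e. $\nu(\mu_{2m})=2m\,\alpha(\mu_{2m})$. Moreover, the resonance locations satisfy the asymptotic expansion $$\mu_{2m}=\mu_0-\left(\frac{\nu_0}{2am}\right)^{1/p}+o\!\left(m^{-1/p}\right),\qquad m\to\infty.$$
   Context: Eigenvalues are listed with multiplicity. Here $\mathbb N=\{1,2,\dots\}$.
   Formalization: The resonance ν(μ_{2m})=2mα(μ_{2m}) is asserted for all sufficiently large m, and for each m≥1 such that ν/α≤2m at some μ<μ0 in V, instead of for every m∈ℕ: if V is small, low-order resonances need not exist. *)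

theory Defs
  imports
    "HOL-Analysis.Analysis"
    "HOL-Computational_Algebra.Polynomial"
    "HOL-Library.Landau_Symbols"
begin

text \<open>
  On an open set of a finite-dimensional space this is the usual class \<open>C\<^sup>k\<close>: continuity of
  \<open>x \<mapsto> Df(x)\<close> is equivalent to continuity of all directional derivatives \<open>x \<mapsto> Df(x) v\<close>.
\<close>
primrec Ck_on :: "nat \<Rightarrow> ('a::euclidean_space \<Rightarrow> 'b::euclidean_space) \<Rightarrow> 'a set \<Rightarrow> bool" where
  "Ck_on 0 f S \<longleftrightarrow> continuous_on S f"
| "Ck_on (Suc k) f S \<longleftrightarrow>
     (\<forall>x\<in>S. f differentiable (at x)) \<and> (\<forall>v. Ck_on k (\<lambda>x. frechet_derivative f (at x) v) S)"

text \<open>\<open>det(zI - A)\<close> as a polynomial in \<open>z\<close> with complex coefficients\<close>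
definition cpoly :: "real^'n^'n \<Rightarrow> complex poly" where
  "cpoly A = det (\<chi> i j. (if i = j then [:0, 1:] else 0) - [:complex_of_real (A $ i $ j):])"

text \<open>\<open>ev 1, \<dots>, ev N\<close> are the complex eigenvalues of \<open>A\<close>, with algebraic multiplicity.\<close>
definition lists_eigenvalues :: "real^'n^'n \<Rightarrow> (nat \<Rightarrow> complex) \<Rightarrow> bool" where
  "lists_eigenvalues A ev \<longleftrightarrow> cpoly A = (\<Prod>i = 1..CARD('n). [:- ev i, 1:])"

definition simple_eigenvalue :: "real^'n^'n \<Rightarrow> complex \<Rightarrow> bool" where
  "simple_eigenvalue A z \<longleftrightarrow> order z (cpoly A) = 1"

definition nonresonant :: "real \<Rightarrow> real \<Rightarrow> bool" where
  "nonresonant \<alpha> \<nu> \<longleftrightarrow>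
     (\<forall>m::nat. 2 \<le> 2 * m \<and> int (2 * m) \<le> \<lfloor>\<nu> / \<alpha>\<rfloor> + 1 \<longrightarrow> \<nu> \<noteq> real (2 * m) * \<alpha>)"

end

theory Submission
  imports Defs
begin

text \<open>
  For \<open>\<mu> \<le> \<mu>0\<close> the eigenvalues are numbered by decreasing real part, so \<open>\<alpha>\<close> and \<open>\<nu>\<close> are the
  first and third entries of the sorted list of real parts of the spectrum. Sorted real parts of
  roots depend continuously on the matrix: along a convergent sequence of matrices the spectra are
  bounded, and any limit of a subsequence is again sorted and has the same characteristic
  polynomial. Hence \<open>\<nu> / \<alpha>\<close> is continuous to the left of \<open>\<mu>0\<close>, and it tends to infinity at \<open>\<mu>0\<close>,
  so it takes all large values \<open>2 * m\<close> there. At such a point \<open>2 * m * (\<mu>0 - \<mu>) ^ p\<close> equals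
  \<open>\<nu> / (\<alpha> / (\<mu>0 - \<mu>) ^ p)\<close>, which tends to \<open>\<nu>0 / a\<close>.
\<close>

section \<open>Bounding eigenvalues by matrix entries\<close>

lemma poly_cpoly: "poly (cpoly A) z = det (mat z - (\<chi> i j. complex_of_real (A $ i $ j)))"
  unfolding cpoly_def det_def
  by (auto simp: poly_sum poly_prod mat_def intro!: sum.cong prod.cong)

text \<open>Compare the rows of \<open>B x = z x\<close> at the largest component of the eigenvector \<open>x\<close>.\<close>

lemma norm_eigenvalue_le:
  fixes B :: "complex^'n^'n"
  assumes "det (mat z - B) = 0"
  shows "norm z \<le> (\<Sum>i\<in>UNIV. \<Sum>j\<in>UNIV. norm (B $ i $ j))"
proof -
  have "\<not> (\<exists>C. C ** (mat z - B) = mat 1)"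
    using assms by (metis det_I det_mul mult_zero_right zero_neq_one)
  then obtain x where x: "(mat z - B) *v x = 0" "x \<noteq> 0"
    unfolding matrix_left_invertible_ker by blast
  have "Max (range (\<lambda>i. norm (x $ i))) \<in> range (\<lambda>i. norm (x $ i))"
    by (intro Max_in) auto
  then obtain k where "norm (x $ k) = Max (range (\<lambda>i. norm (x $ i)))"
    by (metis rangeE)
  then have k: "norm (x $ i) \<le> norm (x $ k)" for i
    by simp
  have k0: "norm (x $ k) > 0"
  proof (rule ccontr)
    assume "\<not> ?thesis"
    then have "x $ i = 0" for i
      using k[of i] by (metis norm_le_zero_iff order_trans not_le)
    then show False using x by (simp add: vec_eq_iff)
  qed
  have "mat z *v x = z *s x"
    by (simp add: vec_eq_iff matrix_vector_mult_def mat_def if_distrib[of "\<lambda>a. a * _"]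
        cong: if_cong)
  then have "B *v x = z *s x"
    using x(1) by (simp add: matrix_vector_mult_diff_rdistrib)
  then have "z * x $ k = (\<Sum>j\<in>UNIV. B $ k $ j * x $ j)"
    by (simp add: vec_eq_iff matrix_vector_mult_def)
  then have "norm z * norm (x $ k) \<le> (\<Sum>j\<in>UNIV. norm (B $ k $ j) * norm (x $ j))"
    by (metis (mono_tags, lifting) norm_mult norm_sum sum.cong)
  also have "\<dots> \<le> (\<Sum>j\<in>UNIV. norm (B $ k $ j)) * norm (x $ k)"
    unfolding sum_distrib_right by (intro sum_mono mult_left_mono k) auto
  finally have "norm z \<le> (\<Sum>j\<in>UNIV. norm (B $ k $ j))"
    using k0 by simp
  also have "\<dots> \<le> (\<Sum>i\<in>UNIV. \<Sum>j\<in>UNIV. norm (B $ i $ j))"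
    by (rule member_le_sum) (auto intro: sum_nonneg)
  finally show ?thesis .
qed

section \<open>Sorted root lists and a subsequence criterion\<close>

lemma image_mset_roots_eq:
  fixes z w :: "'i \<Rightarrow> 'a::idom"
  assumes "finite I" "(\<Prod>i\<in>I. [:- z i, 1:]) = (\<Prod>i\<in>I. [:- w i, 1:])"
  shows "image_mset z (mset_set I) = image_mset w (mset_set I)"
proof -
  have "proots (\<Prod>i\<in>I. [:- u i, 1:]) = image_mset u (mset_set I)" for u :: "'i \<Rightarrow> 'a"
    using \<open>finite I\<close> by (subst proots_prod) (auto simp: sum_unfold_sum_mset multiset.map_comp o_def)
  then show ?thesis using assms by metis
qed

text \<open>A finite multiset has only one decreasing enumeration: reversed, both lists are what
  sorting the same multiset returns. Equal polynomials determine their roots only up to a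
  permutation; this removes that ambiguity for real parts.\<close>

lemma antimono_on_eq_if_mset_eq:
  fixes f g :: "nat \<Rightarrow> 'a::linorder"
  assumes "antimono_on {1..n} f" "antimono_on {1..n} g"
    and "image_mset f (mset_set {1..n}) = image_mset g (mset_set {1..n})"
    and "i \<in> {1..n}"
  shows "f i = g i"
proof -
  have *: "sorted (rev (map h [1..<Suc n]))" if "antimono_on {1..n} h" for h :: "nat \<Rightarrow> 'a"
    using that unfolding sorted_rev_iff_nth_mono by (auto simp: monotone_on_def simp del: upt_Suc)
  have mset: "mset (rev (map h [1..<Suc n])) = image_mset h (mset_set {1..n})" for h :: "nat \<Rightarrow> 'a"
    by (simp only: mset_rev mset_map mset_upt atLeastLessThanSuc_atLeastAtMost)
  have "rev (map f [1..<Suc n]) = rev (map g [1..<Suc n])"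
    using properties_for_sort[OF _ *] mset assms(1-3) by (metis (no_types, lifting))
  then have "map f [1..<Suc n] = map g [1..<Suc n]" by (simp only: rev_is_rev_conv)
  then show ?thesis using assms(4) unfolding map_eq_conv by (simp del: upt_Suc)
qed

text \<open>Otherwise infinitely many terms stay at distance at least some \<open>e > 0\<close> from
  \<open>L\<close>, and enumerating them gives a subsequence none of whose subsequences tends to
  \<open>L\<close>. Compactness yields only subsequences; this turns them into convergence of the
  whole sequence.\<close>

lemma LIMSEQ_subsubseqI:
  fixes X :: "nat \<Rightarrow> 'a::metric_space"
  assumes "\<And>r::nat \<Rightarrow> nat. strict_mono r \<Longrightarrow> \<exists>s::nat \<Rightarrow> nat. strict_mono s \<and> (X \<circ> r \<circ> s) \<longlonglongrightarrow> L"
  shows "X \<longlonglongrightarrow> L"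
proof (rule ccontr)
  assume "\<not> ?thesis"
  then obtain e where e: "e > 0" "\<exists>\<^sub>\<infinity>n. dist (X n) L \<ge> e"
    by (auto simp: tendsto_iff frequently_def not_le cofinite_eq_sequentially)
  define r where "r = enumerate {n. dist (X n) L \<ge> e}"
  have inf: "infinite {n. dist (X n) L \<ge> e}" using e(2) by (simp add: INFM_iff_infinite)
  then have "strict_mono r" unfolding r_def by (rule strict_mono_enumerate)
  then obtain s :: "nat \<Rightarrow> nat" where "(X \<circ> r \<circ> s) \<longlonglongrightarrow> L" using assms by blast
  then have "\<forall>\<^sub>F n in sequentially. dist (X (r (s n))) L < e"
    using e(1) by (auto simp: tendsto_iff)
  moreover have "dist (X (r n)) L \<ge> e" for n
    using enumerate_in_set[OF inf, of n] by (simp add: r_def)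
  ultimately show False by (auto simp: not_le[symmetric])
qed

section \<open>Continuity of the Jacobian along the fixed points\<close>

lemma Ck_on_imp_continuous_on: "Ck_on k f S \<Longrightarrow> continuous_on S f"
  by (cases k) (auto intro!: continuous_at_imp_continuous_on differentiable_imp_continuous_within)

text \<open>By the chain rule the partial derivative in \<open>x\<close> is the full derivative of
  \<open>f\<close> applied to \<open>(v, 0)\<close>. The entries of the Jacobian are thus components
  of directional derivatives of \<open>f\<close>, which are continuous, evaluated along a continuous
  curve.\<close>

lemma continuous_on_jacobian_section:
  fixes f :: "(real^'n) \<times> real \<Rightarrow> real^'m"
  assumes f: "Ck_on (Suc k) f (U \<times> V)" and x0: "continuous_on V x0" "\<And>\<mu>. \<mu> \<in> V \<Longrightarrow> x0 \<mu> \<in> U"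
  shows "continuous_on V (\<lambda>\<mu>. jacobian (\<lambda>x. f (x, \<mu>)) (at (x0 \<mu>)))"
proof -
  let ?D = "\<lambda>v z. frechet_derivative f (at z) v"
  have eq: "jacobian (\<lambda>x. f (x, \<mu>)) (at (x0 \<mu>)) = (\<chi> i j. ?D (axis j 1, 0) (x0 \<mu>, \<mu>) $ i)"
    if "\<mu> \<in> V" for \<mu>
  proof -
    have "f differentiable (at (x0 \<mu>, \<mu>))" using f x0(2) that by auto
    then have "(f has_derivative frechet_derivative f (at (x0 \<mu>, \<mu>))) (at (x0 \<mu>, \<mu>))"
      by (simp add: frechet_derivative_works)
    then have "((\<lambda>x. f (x, \<mu>)) has_derivative (\<lambda>v. ?D (v, 0) (x0 \<mu>, \<mu>))) (at (x0 \<mu>))"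
      by (rule has_derivative_compose[rotated]) (auto intro!: derivative_eq_intros)
    from frechet_derivative_at[OF this, symmetric] show ?thesis
      by (simp add: jacobian_def matrix_def)
  qed
  have cont: "continuous_on V (\<lambda>\<mu>. ?D v (x0 \<mu>, \<mu>))" for v
  proof -
    have "continuous_on (U \<times> V) (?D v)"
      using f unfolding Ck_on.simps by (blast intro: Ck_on_imp_continuous_on)
    moreover have "continuous_on V (\<lambda>\<mu>. (x0 \<mu>, \<mu>))" by (intro continuous_intros x0)
    ultimately show ?thesis by (rule continuous_on_compose2) (use x0 in auto)
  qed
  have "continuous_on V (\<lambda>\<mu>. \<chi> i j. ?D (axis j 1, 0) (x0 \<mu>, \<mu>) $ i)"
    by (intro continuous_on_vec_lambda continuous_on_component cont)
  then show ?thesis using eq by (simp cong: continuous_on_cong)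
qed

section \<open>Continuity of sorted real parts of eigenvalues\<close>

text \<open>Convergence is claimed for real parts only: eigenvalues with equal real parts may be
  listed in any order, so \<open>e n i\<close> itself may oscillate between them.\<close>

lemma tendsto_Re_eigenvalue:
  fixes B :: "nat \<Rightarrow> real^'n^'n"
  assumes B: "B \<longlonglongrightarrow> B0"
    and e: "\<And>n. lists_eigenvalues (B n) (e n)" "\<And>n. antimono_on {1..CARD('n)} (\<lambda>i. Re (e n i))"
    and e0: "lists_eigenvalues B0 e0" "antimono_on {1..CARD('n)} (\<lambda>i. Re (e0 i))"
    and i: "i \<in> {1..CARD('n)}"
  shows "(\<lambda>n. Re (e n i)) \<longlonglongrightarrow> Re (e0 i)"
proof (rule LIMSEQ_subsubseqI)
  fix r :: "nat \<Rightarrow> nat" assume r: "strict_mono r"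
  define C where "C M = (\<chi> i j. complex_of_real (M $ i $ j))" for M :: "real^'n^'n"
  have prod: "det (mat z - C (B n)) = (\<Prod>i = 1..CARD('n). z - e n i)"
    and prod0: "det (mat z - C B0) = (\<Prod>i = 1..CARD('n). z - e0 i)" for n z
    using e(1)[of n] e0(1) poly_cpoly[of "B n" z] poly_cpoly[of B0 z]
    by (simp_all add: lists_eigenvalues_def C_def poly_prod)
  obtain K where K: "\<And>n. norm (B n) \<le> K"
    using convergent_imp_bounded[OF B] by (auto simp: bounded_iff)
  \<comment> \<open>Each entry of \<open>B n\<close> is at most \<open>K\<close> in absolute value.
    The bound is crude, but it is uniform in \<open>n\<close>, which is all that compactness
    requires.\<close>
  have bound: "norm (e n i) \<le> real CARD('n) * (real CARD('n) * K)"
    if "i \<in> {1..CARD('n)}" for n i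
  proof -
    have "det (mat (e n i) - C (B n)) = 0" unfolding prod using that by auto
    then have "norm (e n i) \<le> (\<Sum>i\<in>UNIV. \<Sum>j\<in>UNIV. norm (C (B n) $ i $ j))"
      by (rule norm_eigenvalue_le)
    also have "\<dots> \<le> (\<Sum>i\<in>(UNIV::'n set). \<Sum>j\<in>(UNIV::'n set). K)"
    proof (intro sum_mono)
      fix i j
      have "norm (C (B n) $ i $ j) = norm (B n $ i $ j)" by (simp add: C_def)
      also have "\<dots> \<le> norm (B n $ i)" by (rule Finite_Cartesian_Product.norm_nth_le)
      also have "\<dots> \<le> norm (B n)" by (rule Finite_Cartesian_Product.norm_nth_le)
      finally show "norm (C (B n) $ i $ j) \<le> K" using K[of n] by simp
    qed
    finally show ?thesis by simp
  qed
  \<comment> \<open>Reindexing \<open>{1..CARD('n)}\<close> by the type \<open>'n\<close> makes each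
    eigenvalue list a point of a finite-dimensional space, so one application of Bolzano-Weierstrass
    makes all eigenvalues converge along a common subsequence.\<close>
  obtain h where h: "bij_betw h (UNIV::'n set) {1..CARD('n)}"
    using bij_betw_iff_card[of "UNIV::'n set" "{1..CARD('n)}"] by auto
  define Z where "Z n = (\<chi> k. e n (h k))" for n
  have "norm (Z n) \<le> (\<Sum>k\<in>(UNIV::'n set). real CARD('n) * (real CARD('n) * K))" for n
  proof -
    have "norm (Z n) \<le> (\<Sum>k\<in>UNIV. norm (Z n $ k))"
      unfolding norm_vec_def by (rule L2_set_le_sum) simp
    also have "\<dots> \<le> (\<Sum>k\<in>(UNIV::'n set). real CARD('n) * (real CARD('n) * K))"
      using bij_betwE[OF h] by (intro sum_mono) (auto simp: Z_def intro!: bound)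
    finally show ?thesis .
  qed
  then have "bounded (range (Z \<circ> r))" by (auto simp: bounded_iff)
  then obtain L s where s: "strict_mono s" "(Z \<circ> r \<circ> s) \<longlonglongrightarrow> L"
    using bounded_imp_convergent_subsequence by blast
  define w where "w i = L $ inv_into UNIV h i" for i
  have w: "(\<lambda>n. e (r (s n)) i) \<longlonglongrightarrow> w i" if "i \<in> {1..CARD('n)}" for i
    using tendsto_vec_nth[OF s(2), of "inv_into UNIV h i"] bij_betw_inv_into_right[OF h that]
    by (simp add: Z_def w_def o_def)
  have "(\<lambda>n. B (r (s n))) \<longlonglongrightarrow> B0"
    using LIMSEQ_subseq_LIMSEQ[OF B strict_mono_o[OF r s(1)]] by (simp add: o_def)
  then have CB: "(\<lambda>n. C (B (r (s n))) $ i $ j) \<longlonglongrightarrow> C B0 $ i $ j" for i j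
    unfolding C_def by (auto intro!: tendsto_intros)
  \<comment> \<open>Both sides are limits of the characteristic polynomials at \<open>z\<close>: on
    the left through the factors, on the right through the matrix entries, in which the determinant
    is continuous.\<close>
  have "(\<Prod>i = 1..CARD('n). z - w i) = (\<Prod>i = 1..CARD('n). z - e0 i)" for z
  proof (rule LIMSEQ_unique)
    show "(\<lambda>n. \<Prod>i = 1..CARD('n). z - e (r (s n)) i) \<longlonglongrightarrow> (\<Prod>i = 1..CARD('n). z - w i)"
      by (intro tendsto_intros w)
    show "(\<lambda>n. \<Prod>i = 1..CARD('n). z - e (r (s n)) i) \<longlonglongrightarrow> (\<Prod>i = 1..CARD('n). z - e0 i)"
      unfolding prod[symmetric] prod0[symmetric] det_def by (auto intro!: tendsto_intros CB)
  qed
  then have "(\<Prod>i = 1..CARD('n). [:- w i, 1:]) = (\<Prod>i = 1..CARD('n). [:- e0 i, 1:])"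
    by (simp add: poly_prod fun_eq_iff flip: poly_eq_poly_eq_iff)
  then have "image_mset w (mset_set {1..CARD('n)}) = image_mset e0 (mset_set {1..CARD('n)})"
    by (intro image_mset_roots_eq) simp_all
  then have "image_mset Re (image_mset w (mset_set {1..CARD('n)})) =
      image_mset Re (image_mset e0 (mset_set {1..CARD('n)}))"
    by (rule arg_cong)
  then have mset: "image_mset (\<lambda>i. Re (w i)) (mset_set {1..CARD('n)}) =
      image_mset (\<lambda>i. Re (e0 i)) (mset_set {1..CARD('n)})"
    by (simp only: multiset.map_comp o_def)
  \<comment> \<open>Weak inequalities survive the limit, so \<open>w\<close> and \<open>e0\<close>
    are two decreasing listings of the same real parts.\<close>
  have "antimono_on {1..CARD('n)} (\<lambda>i. Re (w i))"
  proof (rule monotone_onI)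
    fix i j assume ij: "i \<in> {1..CARD('n)}" "j \<in> {1..CARD('n)}" "i \<le> j"
    show "Re (w j) \<le> Re (w i)"
      by (rule tendsto_le[OF _ tendsto_Re[OF w[OF ij(1)]] tendsto_Re[OF w[OF ij(2)]]])
        (use e(2) ij in \<open>auto simp: monotone_on_def\<close>)
  qed
  from antimono_on_eq_if_mset_eq[OF this e0(2) mset i] have "Re (w i) = Re (e0 i)" .
  then show "\<exists>s::nat \<Rightarrow> nat. strict_mono s \<and> ((\<lambda>n. Re (e n i)) \<circ> r \<circ> s) \<longlonglongrightarrow> Re (e0 i)"
    using s(1) tendsto_Re[OF w[OF i]] by (auto simp: o_def)
qed

lemma continuous_on_Re_eigenvalue:
  fixes B :: "'a::metric_space \<Rightarrow> real^'n^'n"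
  assumes "continuous_on S B"
    and "\<And>\<mu>. \<mu> \<in> S \<Longrightarrow> lists_eigenvalues (B \<mu>) (\<lambda>i. e i \<mu>)"
    and "\<And>\<mu>. \<mu> \<in> S \<Longrightarrow> antimono_on {1..CARD('n)} (\<lambda>i. Re (e i \<mu>))"
    and "i \<in> {1..CARD('n)}"
  shows "continuous_on S (\<lambda>\<mu>. Re (e i \<mu>))"
  unfolding continuous_on_sequentially
proof (intro allI ballI impI)
  fix X c assume X: "c \<in> S" "(\<forall>n. X n \<in> S) \<and> X \<longlonglongrightarrow> c"
  then have "(B \<circ> X) \<longlonglongrightarrow> B c"
    using assms(1) unfolding continuous_on_sequentially by blast
  then have "(\<lambda>n. Re (e i (X n))) \<longlonglongrightarrow> Re (e i c)"
    by (rule tendsto_Re_eigenvalue) (use assms X in auto)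
  then show "((\<lambda>\<mu>. Re (e i \<mu>)) \<circ> X) \<longlonglongrightarrow> Re (e i c)" by (simp add: o_def)
qed

section \<open>Resonances of two scalar functions and their asymptotics\<close>

text \<open>Multiplied by m^(1/p), the error is exactly (m d^p)^(1/p) - c^(1/p), which tends to 0
  since the p-th root is continuous at c > 0.\<close>

lemma asymptotic_root_of_power:
  fixes d :: "nat \<Rightarrow> real"
  assumes lim: "(\<lambda>m. real m * d m ^ p) \<longlonglongrightarrow> c" and "c > 0" "p \<ge> 1" and d: "\<And>m. d m \<ge> 0"
  shows "(\<lambda>m. d m - (c / real m) powr (1 / real p)) \<in> o(\<lambda>m. real m powr (- 1 / real p))"
proof (rule smalloI_tendsto)
  have "(\<lambda>m. (real m * d m ^ p) powr (1 / real p) - c powr (1 / real p)) \<longlonglongrightarrow>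
      c powr (1 / real p) - c powr (1 / real p)"
    using \<open>c > 0\<close> by (intro tendsto_intros lim) auto
  then have lim0: "(\<lambda>m. (real m * d m ^ p) powr (1 / real p) - c powr (1 / real p)) \<longlonglongrightarrow> 0" by simp
  \<comment> \<open>Nonnegativity of \<open>d m\<close> is what makes the p-th root of
    \<open>d m ^ p\<close> equal to \<open>d m\<close>. At m = 0 the identity fails: division by
    zero makes the left side 0, while the right side is -c^(1/p).\<close>
  have *: "(d m - (c / real m) powr (1 / real p)) / real m powr (- 1 / real p) =
      (real m * d m ^ p) powr (1 / real p) - c powr (1 / real p)" if "m \<ge> 1" for m
  proof -
    have "(d m ^ p) powr (1 / real p) = d m"
      using d[of m] \<open>p \<ge> 1\<close> by (simp add: powr_powr flip: powr_realpow')
    moreover have "(c / real m) powr (1 / real p) = c powr (1 / real p) / real m powr (1 / real p)"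
      using \<open>c > 0\<close> by (simp add: powr_divide)
    moreover have "real m powr (- 1 / real p) = inverse (real m powr (1 / real p))"
      by (simp add: powr_minus)
    ultimately show ?thesis
      using that d[of m] \<open>c > 0\<close> by (simp only: powr_mult divide_inverse inverse_inverse_eq) (simp add: field_simps)
  qed
  show "(\<lambda>m. (d m - (c / real m) powr (1 / real p)) / real m powr (- 1 / real p)) \<longlonglongrightarrow> 0"
    by (rule Lim_transform_eventually[OF lim0]) (use * in \<open>auto simp: eventually_sequentially intro!: exI[of _ 1]\<close>)
  show "\<forall>\<^sub>F m in sequentially. real m powr (- 1 / real p) \<noteq> 0"
    using eventually_gt_at_top[of 0] by eventually_elim auto
qed

text \<open>For small \<open>m\<close> the quotient \<open>\<nu> / \<alpha>\<close> may exceed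
  \<open>2 * m\<close> everywhere in \<open>V\<close> to the left of \<open>\<mu>0\<close>, and then
  no resonance of that order exists there. Hence the equation comes in two forms: for all large
  \<open>m\<close>, and for each \<open>m\<close> such that the quotient is somewhere at most
  \<open>2 * m\<close>, which are exactly the orders that occur.\<close>

lemma resonance_locations:
  fixes \<alpha> \<nu> :: "real \<Rightarrow> real"
  assumes V: "open V" "connected V" "\<mu>0 \<in> V"
    and cont: "continuous_on (V \<inter> {..<\<mu>0}) \<alpha>" "continuous_on (V \<inter> {..<\<mu>0}) \<nu>"
    and neg: "\<And>\<mu>. \<mu> \<in> V \<Longrightarrow> \<mu> < \<mu>0 \<Longrightarrow> \<alpha> \<mu> < 0"
    and "p \<ge> 1" "a < 0" "\<nu>0 < 0"
    and \<alpha>: "(\<lambda>\<mu>. \<alpha> \<mu> - a * (\<mu>0 - \<mu>) ^ p) \<in> o[at_left \<mu>0](\<lambda>\<mu>. \<bar>\<mu>0 - \<mu>\<bar> ^ p)"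
    and \<nu>: "(\<nu> \<longlongrightarrow> \<nu>0) (at_left \<mu>0)"
  obtains \<mu>res :: "nat \<Rightarrow> real" where
    "\<And>m. \<mu>res m \<in> V" "\<And>m. \<mu>res m < \<mu>0" "\<mu>res \<longlonglongrightarrow> \<mu>0"
    "\<forall>\<^sub>F m in sequentially. \<nu> (\<mu>res m) = real (2 * m) * \<alpha> (\<mu>res m)"
    "\<And>m. \<exists>\<mu>\<in>V. \<mu> < \<mu>0 \<and> \<nu> \<mu> / \<alpha> \<mu> \<le> real (2 * m) \<Longrightarrow>
      \<nu> (\<mu>res m) = real (2 * m) * \<alpha> (\<mu>res m)"
    "(\<lambda>m. \<mu>res m - (\<mu>0 - (\<nu>0 / (2 * a * real m)) powr (1 / real p)))
      \<in> o(\<lambda>m. real m powr (- 1 / real p))"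
proof -
  define g where "g \<mu> = \<nu> \<mu> / \<alpha> \<mu>" for \<mu>
  have left: "\<forall>\<^sub>F \<mu> in at_left \<mu>0. \<mu> < \<mu>0"
    by (simp add: eventually_at_filter)
  have \<alpha>_lim: "((\<lambda>\<mu>. \<alpha> \<mu> / (\<mu>0 - \<mu>) ^ p) \<longlongrightarrow> a) (at_left \<mu>0)"
  proof -
    have "((\<lambda>\<mu>. (\<alpha> \<mu> - a * (\<mu>0 - \<mu>) ^ p) / \<bar>\<mu>0 - \<mu>\<bar> ^ p + a) \<longlongrightarrow> 0 + a) (at_left \<mu>0)"
      by (intro tendsto_intros smalloD_tendsto[OF \<alpha>])
    moreover have "\<forall>\<^sub>F \<mu> in at_left \<mu>0.
        (\<alpha> \<mu> - a * (\<mu>0 - \<mu>) ^ p) / \<bar>\<mu>0 - \<mu>\<bar> ^ p + a = \<alpha> \<mu> / (\<mu>0 - \<mu>) ^ p"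
      using left by eventually_elim (simp add: field_simps)
    ultimately show ?thesis by (simp add: filterlim_cong)
  qed
  \<comment> \<open>Near \<open>\<mu>0\<close>, \<open>g\<close> is a product of a factor tending to
    \<open>\<nu>0 / a > 0\<close> and the inverse of \<open>(\<mu>0 - \<mu>) ^ p\<close>, which
    tends to infinity.\<close>
  have g_top: "filterlim g at_top (at_left \<mu>0)"
  proof -
    have "((\<lambda>\<mu>. (\<mu>0 - \<mu>) ^ p) \<longlongrightarrow> 0) (at_left \<mu>0)"
      using \<open>p \<ge> 1\<close> by (auto intro!: tendsto_eq_intros)
    then have "filterlim (\<lambda>\<mu>. inverse ((\<mu>0 - \<mu>) ^ p)) at_top (at_left \<mu>0)"
      using left by (intro filterlim_inverse_at_top) (auto elim!: eventually_mono)
    moreover have "((\<lambda>\<mu>. \<nu> \<mu> / (\<alpha> \<mu> / (\<mu>0 - \<mu>) ^ p)) \<longlongrightarrow> \<nu>0 / a) (at_left \<mu>0)"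
      using \<open>a < 0\<close> by (intro tendsto_intros \<alpha>_lim \<nu>) auto
    ultimately have "filterlim (\<lambda>\<mu>. \<nu> \<mu> / (\<alpha> \<mu> / (\<mu>0 - \<mu>) ^ p) * inverse ((\<mu>0 - \<mu>) ^ p)) at_top (at_left \<mu>0)"
      by (metis filterlim_tendsto_pos_mult_at_top divide_neg_neg \<open>\<nu>0 < 0\<close> \<open>a < 0\<close>)
    moreover have "\<forall>\<^sub>F \<mu> in at_left \<mu>0.
        \<nu> \<mu> / (\<alpha> \<mu> / (\<mu>0 - \<mu>) ^ p) * inverse ((\<mu>0 - \<mu>) ^ p) = g \<mu>"
      using left by eventually_elim (simp add: g_def field_simps)
    ultimately show ?thesis
      by (rule filterlim_cong[OF refl refl, THEN iffD1, rotated])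
  qed
  have g_cont: "continuous_on (V \<inter> {..<\<mu>0}) g"
    unfolding g_def using neg by (intro continuous_intros cont) fastforce
  have Icc: "{x..y} \<subseteq> V \<inter> {..<\<mu>0}" if "x \<in> V" "y \<in> V" "y < \<mu>0" for x y
    using connected_contains_Icc[OF V(2) that(1,2)] that by auto
  obtain c0 where c0: "c0 \<in> V" "c0 < \<mu>0"
    by (metis V(1,3) lt_ex open_left dense greaterThanAtMost_iff less_imp_le subsetD)
  \<comment> \<open>Just left of \<open>\<mu>0\<close> the quotient exceeds \<open>s\<close>, so the
    intermediate value theorem applies between \<open>y\<close> and a point there. Recording that
    the solution is not left of \<open>y\<close> allows solutions to be kept to the right of
    \<open>c0\<close>.\<close>
  have ivt: "\<exists>x\<ge>y. x \<in> V \<and> x < \<mu>0 \<and> g x = s" if y: "y \<in> V" "y < \<mu>0" "g y \<le> s" for y s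
  proof -
    have "\<forall>\<^sub>F \<mu> in at_left \<mu>0. s \<le> g \<mu>"
      using g_top by (simp add: filterlim_at_top)
    moreover have "\<forall>\<^sub>F \<mu> in at_left \<mu>0. y < \<mu> \<and> \<mu> < \<mu>0"
      using eventually_at_left_real[OF y(2)] by simp
    ultimately have "\<forall>\<^sub>F \<mu> in at_left \<mu>0. s \<le> g \<mu> \<and> y < \<mu> \<and> \<mu> < \<mu>0"
      by (rule eventually_conj)
    then obtain z where z: "s \<le> g z" "y < z" "z < \<mu>0"
      by (auto dest!: eventually_happens)
    have "z \<in> V" using connected_contains_Icc[OF V(2) y(1) V(3)] z by auto
    from Icc[OF y(1) this z(3)] have sub: "{y..z} \<subseteq> V \<inter> {..<\<mu>0}" .
    have "\<exists>x\<ge>y. x \<le> z \<and> g x = s"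
      using y z by (intro IVT' continuous_on_subset[OF g_cont sub]) auto
    then show ?thesis using sub by fastforce
  qed
  text \<open>Away from \<open>\<mu>0\<close> the quotient \<open>g\<close> can take the value \<open>2 * m\<close> for large \<open>m\<close> too, near the
    left end of \<open>V\<close>; choosing locations to the right of \<open>c0\<close> whenever possible forces convergence
    to \<open>\<mu>0\<close>.\<close>
  have "\<exists>x. x \<in> V \<and> x < \<mu>0 \<and> ((\<exists>y\<in>V. y < \<mu>0 \<and> g y \<le> 2 * m) \<longrightarrow> g x = 2 * m)
      \<and> (g c0 \<le> 2 * m \<longrightarrow> c0 \<le> x)" for m :: real
    by (metis c0 ivt)
  then have "\<forall>m::nat. \<exists>x. x \<in> V \<and> x < \<mu>0 \<and> ((\<exists>y\<in>V. y < \<mu>0 \<and> g y \<le> 2 * real m) \<longrightarrow> g x = 2 * real m)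
      \<and> (g c0 \<le> 2 * real m \<longrightarrow> c0 \<le> x)" by blast
  then obtain \<mu>res :: "nat \<Rightarrow> real" where res: "\<And>m. \<mu>res m \<in> V" "\<And>m. \<mu>res m < \<mu>0"
    "\<And>m. \<exists>y\<in>V. y < \<mu>0 \<and> g y \<le> 2 * real m \<Longrightarrow> g (\<mu>res m) = 2 * real m"
    "\<And>m. g c0 \<le> 2 * real m \<Longrightarrow> c0 \<le> \<mu>res m" by metis
  have large: "\<forall>\<^sub>F m in sequentially. s < 2 * real m" for s
  proof -
    have "\<forall>\<^sub>F m in sequentially. s / 2 < real m"
      using filterlim_real_sequentially unfolding filterlim_at_top_dense by blast
    then show ?thesis by eventually_elim simp
  qed
  have ev_res: "\<forall>\<^sub>F m in sequentially. g (\<mu>res m) = 2 * real m \<and> c0 \<le> \<mu>res m"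
    using large[of "g c0"] by eventually_elim (use c0 res in force)
  have resI: "\<nu> (\<mu>res m) = real (2 * m) * \<alpha> (\<mu>res m)" if "g (\<mu>res m) = 2 * real m" for m
    using that neg[OF res(1,2)[of m]] by (simp add: g_def field_simps)
  \<comment> \<open>On the compact interval from \<open>c0\<close> to \<open>c'\<close> the quotient
    is bounded by some \<open>M\<close>. For large \<open>m\<close> the location is not left of
    \<open>c0\<close> and its value \<open>2 * m\<close> exceeds \<open>M\<close>, so it lies beyond
    \<open>c'\<close>. Taking the maximum with \<open>c0\<close> keeps the interval nonempty and
    inside \<open>V\<close>.\<close>
  have lim: "\<mu>res \<longlonglongrightarrow> \<mu>0"
  proof (rule order_tendstoI)
    fix c assume "c < \<mu>0"
    define c' where "c' = max c c0"
    have c': "c' \<in> V" "c' < \<mu>0" "c \<le> c'" "c0 \<le> c'"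
      using \<open>c < \<mu>0\<close> c0 connected_contains_Icc[OF V(2) c0(1) V(3)] by (auto simp: c'_def)
    have "bounded (g ` {c0..c'})"
      by (intro compact_imp_bounded compact_continuous_image continuous_on_subset[OF g_cont Icc] c0 c')
        simp
    then obtain M where "\<forall>y\<in>g ` {c0..c'}. norm y \<le> M"
      unfolding bounded_iff by blast
    then have M: "g x \<le> M" if "x \<in> {c0..c'}" for x
      using that by (fastforce simp: abs_le_iff)
    show "\<forall>\<^sub>F m in sequentially. c < \<mu>res m"
      using large[of M] ev_res
    proof eventually_elim
      case (elim m)
      then have "\<not> \<mu>res m \<le> c'" using M[of "\<mu>res m"] by auto
      then show ?case using c' by simp
    qed
  next
    fix c assume "\<mu>0 < c"
    then show "\<forall>\<^sub>F m in sequentially. \<mu>res m < c"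
      using res(2) by (intro always_eventually) (meson order.strict_trans)
  qed
  then have lim_left: "filterlim \<mu>res (at_left \<mu>0) sequentially"
    using res(2) by (auto intro!: tendsto_imp_filterlim_at_left)
  \<comment> \<open>Inserting the resonance equation turns this expression into
    \<open>real m * (\<mu>0 - \<mu>res m) ^ p\<close>; the division by 2 cancels the 2 in
    \<open>2 * m\<close> and yields the constant \<open>\<nu>0 / (2 * a)\<close>.\<close>
  have "(\<lambda>m. \<nu> (\<mu>res m) / (\<alpha> (\<mu>res m) / (\<mu>0 - \<mu>res m) ^ p) / 2) \<longlonglongrightarrow> \<nu>0 / a / 2"
    using \<open>a < 0\<close>
    by (intro tendsto_intros filterlim_compose[OF \<nu> lim_left] filterlim_compose[OF \<alpha>_lim lim_left]) auto
  moreover have "\<forall>\<^sub>F m in sequentially.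
      \<nu> (\<mu>res m) / (\<alpha> (\<mu>res m) / (\<mu>0 - \<mu>res m) ^ p) / 2 = real m * (\<mu>0 - \<mu>res m) ^ p"
    using ev_res
  proof eventually_elim
    case (elim m)
    then show ?case using resI[of m] neg[OF res(1,2)[of m]] by (simp add: field_simps)
  qed
  ultimately have "(\<lambda>m. real m * (\<mu>0 - \<mu>res m) ^ p) \<longlonglongrightarrow> \<nu>0 / a / 2"
    by (rule Lim_transform_eventually)
  from asymptotic_root_of_power[OF this _ \<open>p \<ge> 1\<close>]
  have "(\<lambda>m. \<mu>0 - \<mu>res m - (\<nu>0 / a / 2 / real m) powr (1 / real p)) \<in> o(\<lambda>m. real m powr (- 1 / real p))"
    using \<open>a < 0\<close> \<open>\<nu>0 < 0\<close> res(2) by (simp add: divide_neg_neg less_imp_le)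
  \<comment> \<open>The estimate so far concerns the distance to \<open>\<mu>0\<close>; negation
    turns it into one for the location.\<close>
  then have "(\<lambda>m. - (\<mu>0 - \<mu>res m - (\<nu>0 / a / 2 / real m) powr (1 / real p))) \<in> o(\<lambda>m. real m powr (- 1 / real p))"
    by (simp only: landau_o.small.uminus_in_iff)
  then have asym: "(\<lambda>m. \<mu>res m - (\<mu>0 - (\<nu>0 / (2 * a * real m)) powr (1 / real p)))
      \<in> o(\<lambda>m. real m powr (- 1 / real p))"
    by (simp add: algebra_simps)
  have "\<forall>\<^sub>F m in sequentially. \<nu> (\<mu>res m) = real (2 * m) * \<alpha> (\<mu>res m)"
    using ev_res by eventually_elim (blast intro: resI)
  moreover have "\<nu> (\<mu>res m) = real (2 * m) * \<alpha> (\<mu>res m)"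
    if "\<exists>\<mu>\<in>V. \<mu> < \<mu>0 \<and> \<nu> \<mu> / \<alpha> \<mu> \<le> real (2 * m)" for m
    using that by (intro resI res(3)) (simp add: g_def)
  ultimately show thesis by (rule that[OF res(1,2) lim _ _ asym])
qed

section \<open>Application to the eigenvalues of the linearization\<close>

theorem lemma3p2:
  fixes f :: "(real^'n) \<times> real \<Rightarrow> real^'n"
    and U :: "(real^'n) set" and V :: "real set"
    and r p :: nat
    and x0 :: "real \<Rightarrow> real^'n"
    and A :: "real \<Rightarrow> real^'n^'n"
    and ev :: "nat \<Rightarrow> real \<Rightarrow> complex"
    and \<alpha> \<omega> \<nu> :: "real \<Rightarrow> real"
    and \<mu>0 a b \<nu>0 :: real
  assumes "CARD('n) \<ge> 3" and "r > 1"
    and "open U" and "connected U" and "open V" and "connected V"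
    and "Ck_on (r + 1) f (U \<times> V)"
    and "\<And>\<mu>. \<mu> \<in> V \<Longrightarrow> x0 \<mu> \<in> U \<and> f (x0 \<mu>, \<mu>) = 0"
    and "Ck_on r x0 V"
    and "\<And>\<mu>. \<mu> \<in> V \<Longrightarrow> A \<mu> = jacobian (\<lambda>x. f (x, \<mu>)) (at (x0 \<mu>))"
    and "\<And>\<mu>. \<mu> \<in> V \<Longrightarrow> lists_eigenvalues (A \<mu>) (\<lambda>i. ev i \<mu>)"
    and "\<mu>0 \<in> V"
    and A4_pair: "\<And>\<mu>. \<mu> \<in> V \<Longrightarrow>
          ev 1 \<mu> = Complex (\<alpha> \<mu>) (\<omega> \<mu>) \<and> ev 2 \<mu> = Complex (\<alpha> \<mu>) (- \<omega> \<mu>) \<and> \<omega> \<mu> \<noteq> 0"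
    and A4_crossing: "\<alpha> \<mu>0 = 0"
          "\<And>\<mu>. \<mu> \<in> V \<Longrightarrow> \<mu> < \<mu>0 \<Longrightarrow> \<alpha> \<mu> < 0"
          "\<And>\<mu>. \<mu> \<in> V \<Longrightarrow> \<mu> > \<mu>0 \<Longrightarrow> \<alpha> \<mu> > 0"
    and A4_rest: "\<And>\<mu>. \<mu> \<in> V \<Longrightarrow> Re (ev 3 \<mu>) < 0"
          "\<And>\<mu> i j. \<mu> \<in> V \<Longrightarrow> 3 \<le> i \<Longrightarrow> i \<le> j \<Longrightarrow> j \<le> CARD('n) \<Longrightarrow> Re (ev j \<mu>) \<le> Re (ev i \<mu>)"
    and A5: "\<And>\<mu>. \<mu> \<in> V \<Longrightarrow> \<mu> \<le> \<mu>0 \<Longrightarrow>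
          ev 3 \<mu> = complex_of_real (\<nu> \<mu>) \<and> \<nu> \<mu> < 0 \<and> \<nu> \<mu> < Re (ev 1 \<mu>) \<and> \<nu> \<mu> < Re (ev 2 \<mu>)"
    and A6_simple: "\<And>\<mu> i. \<mu> \<in> V \<Longrightarrow> i \<in> {1, 2, 3} \<Longrightarrow> simple_eigenvalue (A \<mu>) (ev i \<mu>)"
    and A6_disjoint: "\<And>\<mu> i j. \<mu> \<in> V \<Longrightarrow> i \<in> {1, 2, 3} \<Longrightarrow> 4 \<le> j \<Longrightarrow> j \<le> CARD('n) \<Longrightarrow>
          ev i \<mu> \<noteq> ev j \<mu>"
    and "1 \<le> p" and "p \<le> r" and "a < 0" and "\<nu>0 < 0"
    and \<alpha>_expansion:
      "(\<lambda>\<mu>. \<alpha> \<mu> - a * (\<mu>0 - \<mu>) ^ p) \<in> o[at_left \<mu>0](\<lambda>\<mu>. \<bar>\<mu>0 - \<mu>\<bar> ^ p)"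
    and \<nu>_expansion:
      "(\<lambda>\<mu>. \<nu> \<mu> - (\<nu>0 + b * (\<mu>0 - \<mu>))) \<in> o[at_left \<mu>0](\<lambda>\<mu>. \<bar>\<mu>0 - \<mu>\<bar>)"
  shows "\<exists>\<mu>res :: nat \<Rightarrow> real.
           (\<forall>m\<ge>1. \<mu>res m \<in> V \<and> \<mu>res m < \<mu>0)
         \<and> \<mu>res \<longlonglongrightarrow> \<mu>0
         \<and> (\<forall>\<^sub>F m in sequentially.
              \<not> nonresonant (\<alpha> (\<mu>res m)) (\<nu> (\<mu>res m)) \<and>
              \<nu> (\<mu>res m) = real (2 * m) * \<alpha> (\<mu>res m))
         \<and> (\<forall>m\<ge>1. (\<exists>\<mu>\<in>V. \<mu> < \<mu>0 \<and> \<nu> \<mu> / \<alpha> \<mu> \<le> real (2 * m)) \<longrightarrow>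
              \<not> nonresonant (\<alpha> (\<mu>res m)) (\<nu> (\<mu>res m)) \<and>
              \<nu> (\<mu>res m) = real (2 * m) * \<alpha> (\<mu>res m))
         \<and> (\<lambda>m. \<mu>res m - (\<mu>0 - (\<nu>0 / (2 * a * real m)) powr (1 / real p)))
              \<in> o(\<lambda>m. real m powr (- 1 / real p))"
proof -
  let ?S = "V \<inter> {..\<mu>0}"
  have A_cont: "continuous_on V A"
  proof -
    have "continuous_on V (\<lambda>\<mu>. jacobian (\<lambda>x. f (x, \<mu>)) (at (x0 \<mu>)))"
      using assms(7,8,9)
      by (intro continuous_on_jacobian_section[where k = r and U = U] Ck_on_imp_continuous_on) auto
    then show ?thesis using assms(10) by (simp cong: continuous_on_cong)
  qed
  \<comment> \<open>The complex pair shares its real part, \<open>A5\<close> puts the third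
    eigenvalue below it, and \<open>A4_rest\<close> orders the remaining ones.\<close>
  have mono: "antimono_on {1..CARD('n)} (\<lambda>i. Re (ev i \<mu>))" if \<mu>: "\<mu> \<in> ?S" for \<mu>
  proof (rule monotone_onI)
    fix i j assume ij: "i \<in> {1..CARD('n)}" "j \<in> {1..CARD('n)}" "i \<le> j"
    have le3: "Re (ev k \<mu>) \<le> Re (ev 3 \<mu>)" if "k \<in> {3..CARD('n)}" for k
      using A4_rest(2)[of \<mu> 3 k] that \<mu> by auto
    have "Re (ev 1 \<mu>) = Re (ev 2 \<mu>)" "Re (ev 3 \<mu>) \<le> Re (ev 2 \<mu>)"
      using A4_pair[of \<mu>] A5[of \<mu>] \<mu> by auto
    moreover have "i = 1 \<or> i = 2 \<or> 3 \<le> i" "j = 1 \<or> j = 2 \<or> 3 \<le> j"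
      using ij by auto
    ultimately show "Re (ev j \<mu>) \<le> Re (ev i \<mu>)"
      using ij le3[of j] A4_rest(2)[of \<mu> i j] \<mu> by fastforce
  qed
  have Re_cont: "continuous_on ?S (\<lambda>\<mu>. Re (ev i \<mu>))" if "i \<in> {1..CARD('n)}" for i
    using assms(11) mono that
    by (intro continuous_on_Re_eigenvalue[where B = A] continuous_on_subset[OF A_cont]) auto
  have "continuous_on (V \<inter> {..<\<mu>0}) (\<lambda>\<mu>. Re (ev 1 \<mu>))"
    using assms(1) by (intro continuous_on_subset[OF Re_cont]) auto
  then have \<alpha>_cont: "continuous_on (V \<inter> {..<\<mu>0}) \<alpha>"
    by (rule continuous_on_eq) (use A4_pair in auto)
  have "continuous_on (V \<inter> {..<\<mu>0}) (\<lambda>\<mu>. Re (ev 3 \<mu>))"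
    using assms(1) by (intro continuous_on_subset[OF Re_cont]) auto
  then have \<nu>_cont: "continuous_on (V \<inter> {..<\<mu>0}) \<nu>"
    by (rule continuous_on_eq) (use A5 in auto)
  \<comment> \<open>Dividing the remainder by the distance to \<open>\<mu>0\<close> and multiplying
    back shows that it vanishes in the limit, as does the linear term.\<close>
  have \<nu>_lim: "(\<nu> \<longlongrightarrow> \<nu>0) (at_left \<mu>0)"
  proof -
    have "((\<lambda>\<mu>. (\<nu> \<mu> - (\<nu>0 + b * (\<mu>0 - \<mu>))) / \<bar>\<mu>0 - \<mu>\<bar> * \<bar>\<mu>0 - \<mu>\<bar> + (\<nu>0 + b * (\<mu>0 - \<mu>)))
        \<longlongrightarrow> 0 * \<bar>\<mu>0 - \<mu>0\<bar> + (\<nu>0 + b * (\<mu>0 - \<mu>0))) (at_left \<mu>0)"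
      by (intro tendsto_intros smalloD_tendsto[OF \<nu>_expansion])
    moreover have "\<forall>\<^sub>F \<mu> in at_left \<mu>0.
        (\<nu> \<mu> - (\<nu>0 + b * (\<mu>0 - \<mu>))) / \<bar>\<mu>0 - \<mu>\<bar> * \<bar>\<mu>0 - \<mu>\<bar> + (\<nu>0 + b * (\<mu>0 - \<mu>)) = \<nu> \<mu>"
      by (simp add: eventually_at_filter)
    ultimately have "(\<nu> \<longlongrightarrow> 0 * \<bar>\<mu>0 - \<mu>0\<bar> + (\<nu>0 + b * (\<mu>0 - \<mu>0))) (at_left \<mu>0)"
      by (rule Lim_transform_eventually)
    then show ?thesis by simp
  qed
  \<comment> \<open>At a resonance the quotient is the integer \<open>2 * m\<close>, hence equal to
    its own floor, so this \<open>m\<close> lies within the range that \<open>nonresonant\<close>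
    tests; \<open>m \<ge> 1\<close> supplies the lower end.\<close>
  have res: "\<not> nonresonant (\<alpha> \<mu>) (\<nu> \<mu>)"
    if "\<mu> \<in> V" "\<mu> < \<mu>0" "m \<ge> 1" "\<nu> \<mu> = real (2 * m) * \<alpha> \<mu>" for \<mu> and m :: nat
  proof -
    have "\<nu> \<mu> / \<alpha> \<mu> = real (2 * m)" using that A4_crossing(2)[of \<mu>] by simp
    then have "\<lfloor>\<nu> \<mu> / \<alpha> \<mu>\<rfloor> = int (2 * m)" by (simp only: floor_of_nat)
    then show ?thesis using that unfolding nonresonant_def by (intro notI) auto
  qed
  show ?thesis
  proof (rule resonance_locations[OF \<open>open V\<close> \<open>connected V\<close> \<open>\<mu>0 \<in> V\<close> \<alpha>_cont \<nu>_cont A4_crossing(2)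
        \<open>1 \<le> p\<close> \<open>a < 0\<close> \<open>\<nu>0 < 0\<close> \<alpha>_expansion \<nu>_lim])
    fix \<mu>res :: "nat \<Rightarrow> real"
    assume V: "\<And>m. \<mu>res m \<in> V" "\<And>m. \<mu>res m < \<mu>0"
      and lim: "\<mu>res \<longlonglongrightarrow> \<mu>0"
      and ev_eq: "\<forall>\<^sub>F m in sequentially. \<nu> (\<mu>res m) = real (2 * m) * \<alpha> (\<mu>res m)"
      and eq: "\<And>m. \<exists>\<mu>\<in>V. \<mu> < \<mu>0 \<and> \<nu> \<mu> / \<alpha> \<mu> \<le> real (2 * m) \<Longrightarrow>
        \<nu> (\<mu>res m) = real (2 * m) * \<alpha> (\<mu>res m)"
      and asym: "(\<lambda>m. \<mu>res m - (\<mu>0 - (\<nu>0 / (2 * a * real m)) powr (1 / real p)))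
        \<in> o(\<lambda>m. real m powr (- 1 / real p))"
    have res': "\<not> nonresonant (\<alpha> (\<mu>res m)) (\<nu> (\<mu>res m)) \<and>
        \<nu> (\<mu>res m) = real (2 * m) * \<alpha> (\<mu>res m)"
      if "m \<ge> 1" "\<nu> (\<mu>res m) = real (2 * m) * \<alpha> (\<mu>res m)" for m
      using res[OF V that] that(2) by (rule conjI)
    have "\<forall>\<^sub>F m in sequentially. \<not> nonresonant (\<alpha> (\<mu>res m)) (\<nu> (\<mu>res m)) \<and>
        \<nu> (\<mu>res m) = real (2 * m) * \<alpha> (\<mu>res m)"
      using eventually_ge_at_top[of 1] ev_eq by eventually_elim (rule res')
    moreover have "\<forall>m\<ge>1. (\<exists>\<mu>\<in>V. \<mu> < \<mu>0 \<and> \<nu> \<mu> / \<alpha> \<mu> \<le> real (2 * m)) \<longrightarrow>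
        \<not> nonresonant (\<alpha> (\<mu>res m)) (\<nu> (\<mu>res m)) \<and>
        \<nu> (\<mu>res m) = real (2 * m) * \<alpha> (\<mu>res m)"
      by (intro allI impI res' eq)
    moreover have "\<forall>m\<ge>1. \<mu>res m \<in> V \<and> \<mu>res m < \<mu>0"
      using V by simp
    ultimately show ?thesis
      using lim asym by (intro exI[of _ \<mu>res] conjI)
  qed
qed

end
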